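(* Let $k,n,q\in\mathbb{N}$, let $\Sigma$ be a finite alphabet, let $\sigma>0$ and $\delta>n^{-\frac{\sigma}{2q}}$. Let $C:\{0,1\}^k\to\Sigma^n$ be a code that has a non-adaptive $(q,\delta,\sigma)$-relaxed decoder. Then \[ n \ \ge\ \left(\frac{\sigma^2\cdot k}{38\, q^4 \log^2(|\Sigma|)\cdot \log^2 k}\right)^{1+\frac{1}{\lceil q/\sigma\rceil}}. \]
   Context: Logarithms are base 2. For $w,w'\in\Sigma^n$, $\mathrm{dist}(w,w')$ is the relative Hamming distance (fraction of coordinates where they differ). A $(q,\delta,\sigma)$-relaxed decoder for $C:\{0,1\}^k\to\Sigma^n$ is a randomized procedure $\mathcal{B}$ that, on explicit input $i\in[k]$ and oracle access to $w\in\Sigma^n$, outputs an element of $\{0,1,\bot\}$ and satisfies: (1) (completeness) if $w=C(x)$ for some $x\in\{0,1\}^k$ then $\mathcal{B}^w(i)=x_i$ with probability 1; (2) (relaxed local decoding) if there is $x\in\{0,1\}^k$ with $\mathrm{dist}(w,C(x))\le\delta$, then $\Pr[\mathcal{B}^w(i)\in\{x_i,\bot\}]\ge\sigma$; (3) for every $i$ and every $w$, $\mathcal{B}$ makes at most $q$ queries to $w$. The decoder is non-adaptive if its queries are determined by $i$ and its internal coin tosses only, independently of $w$. *)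

theory Defs
  imports "HOL-Probability.Probability"
begin

text \<open>Words are lists: \<open>\<Sigma>\<^sup>n\<close> is the set of lists of length \<open>n\<close> over a finite type,
  \<open>{0,1}\<^sup>k\<close> is the set of \<open>bool\<close> lists of length \<open>k\<close>, and coordinates are counted from 0.\<close>

definition rel_hamming_dist :: "'a list \<Rightarrow> 'a list \<Rightarrow> real" where
  "rel_hamming_dist w w' = real (card {j. j < length w \<and> w ! j \<noteq> w' ! j}) / real (length w)"

text \<open>A deterministic algorithm with oracle access to a word. Each query may depend on the
  answers to the earlier ones. The output \<open>None\<close> stands for \<open>\<bottom>\<close>.\<close>

datatype 'a oracle_alg =
    Output "bool option"
  | Query nat "'a \<Rightarrow> 'a oracle_alg"

primrec run :: "'a oracle_alg \<Rightarrow> 'a list \<Rightarrow> bool option" where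
  "run (Output b) w = b"
| "run (Query j f) w = run (f (w ! j)) w"

primrec queries :: "'a oracle_alg \<Rightarrow> 'a list \<Rightarrow> nat list" where
  "queries (Output b) w = []"
| "queries (Query j f) w = j # queries (f (w ! j)) w"

text \<open>A randomized procedure is given by a distribution \<open>R\<close> of its internal coin tosses
  and, for each explicit input \<open>i\<close> and each outcome \<open>r\<close> of the coin tosses, the
  deterministic oracle algorithm \<open>B i r\<close>. Queries count with multiplicity and
  must be positions of the oracle word.\<close>

definition relaxed_decoder ::
  "nat \<Rightarrow> nat \<Rightarrow> nat \<Rightarrow> real \<Rightarrow> real \<Rightarrow> (bool list \<Rightarrow> 'a list)
    \<Rightarrow> 'r pmf \<Rightarrow> (nat \<Rightarrow> 'r \<Rightarrow> 'a oracle_alg) \<Rightarrow> bool" where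
  "relaxed_decoder k n q \<delta> \<sigma> C R B \<longleftrightarrow>
    (\<forall>i<k. \<forall>x. length x = k \<longrightarrow>
       measure_pmf.prob R {r. run (B i r) (C x) = Some (x ! i)} = 1) \<and>
    (\<forall>i<k. \<forall>w x. length w = n \<longrightarrow> length x = k \<longrightarrow> rel_hamming_dist w (C x) \<le> \<delta> \<longrightarrow>
       measure_pmf.prob R {r. run (B i r) w \<in> {Some (x ! i), None}} \<ge> \<sigma>) \<and>
    (\<forall>i<k. \<forall>w. length w = n \<longrightarrow> (\<forall>r\<in>set_pmf R.
       length (queries (B i r) w) \<le> q \<and> set (queries (B i r) w) \<subseteq> {..<n}))"

definition nonadaptive ::
  "nat \<Rightarrow> nat \<Rightarrow> 'r pmf \<Rightarrow> (nat \<Rightarrow> 'r \<Rightarrow> 'a oracle_alg) \<Rightarrow> bool" where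
  "nonadaptive k n R B \<longleftrightarrow>
    (\<forall>i<k. \<forall>r\<in>set_pmf R. \<exists>Q. \<forall>w. length w = n \<longrightarrow> queries (B i r) w = Q)"

end

theory Submission
  imports Defs
begin

text \<open>Idea. Fix \<open>i\<close> and let \<open>d v\<close> be the probability that coordinate \<open>v\<close> is queried. For
  \<open>p0 = n powr (- 1 / M)\<close> let the kernel \<open>K m\<close> consist of the coordinates with \<open>d v \<ge> q * p0 ^ m\<close>, so
  that it has at most \<open>1 / p0 ^ m\<close> elements. Call level \<open>m\<close> bad for a query set if, for some
  \<open>j \<ge> 1\<close>, at least \<open>j\<close> of the queries lie in \<open>K (m + j) - K m\<close>. As for parking functions, a set of
  \<open>q\<close> queries has at most \<open>q\<close> bad levels, so one of \<open>M\<close> levels is bad with probability at most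
  \<open>q / M < \<sigma>\<close>. At a good level the \<open>j\<close>-th most popular query outside the kernel has
  \<open>d v < q * p0 ^ (m + j)\<close>.

  Sample \<open>S\<close> in \<open>q\<close> rounds, each coordinate with probability \<open>p = A * p0\<close> per round, the \<open>j\<close>-th round
  being responsible for the \<open>j\<close>-th query outside the kernel. The degree bounds keep an exponential
  moment under control: a family of good query sets of probability \<open>\<epsilon>\<close> has a member inside
  \<open>K m \<union> S\<close>, except with probability at most \<open>exp (- A * \<epsilon> / (2 * q * p0 ^ m))\<close>, which for suitable
  \<open>A\<close> beats the number of assignments to the kernel. Soundness, applied to \<open>C x\<close> overwritten on
  the kernel by \<open>C y\<close> (at distance at most \<open>\<delta>\<close> from \<open>C x\<close>), then shows that two messages whose
  codewords agree on \<open>S\<close> coincide, for at least half of all messages. Hence \<open>k\<close> is essentially at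
  most \<open>card S\<close> times the logarithm of the alphabet size, with \<open>card S\<close> of order \<open>q * p * n\<close>.\<close>

section \<open>Expected counts, bad levels and enumerations\<close>

lemma run_cong:
  assumes "\<And>j. j \<in> set (queries A w) \<Longrightarrow> w ! j = w' ! j"
  shows "run A w = run A w'"
  using assms by (induction A) auto

text \<open>Linearity of expectation: the sum is the expected number of \<open>i\<close> in
  \<open>I\<close> with \<open>P i r\<close>. It serves for the queried coordinates and for the bad
  levels, both at most \<open>q\<close> in number for each outcome.\<close>

lemma sum_prob_le:
  fixes R :: "'r pmf"
  assumes "finite I" "\<And>r. r \<in> set_pmf R \<Longrightarrow> real (card {i\<in>I. P i r}) \<le> b"
  shows "(\<Sum>i\<in>I. measure_pmf.prob R {r. P i r}) \<le> b"
proof -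
  have "(\<Sum>i\<in>I. measure_pmf.prob R {r. P i r})
      = (\<Sum>i\<in>I. measure_pmf.expectation R (indicator {r. P i r}))"
    by simp
  also have "\<dots> = measure_pmf.expectation R (\<lambda>r. \<Sum>i\<in>I. indicator {r. P i r} r)"
    by (rule Bochner_Integration.integral_sum[symmetric])
      (auto intro!: measure_pmf.integrable_const_bound[where B = 1])
  also have "\<dots> \<le> measure_pmf.expectation R (\<lambda>r. b)"
  proof (rule integral_mono_AE)
    show "integrable (measure_pmf R) (\<lambda>r. \<Sum>i\<in>I. indicator {r. P i r} r :: real)"
      by (rule Bochner_Integration.integrable_sum)
        (auto intro!: measure_pmf.integrable_const_bound[where B = 1])
    show "AE r in measure_pmf R. (\<Sum>i\<in>I. indicator {r. P i r} r) \<le> b"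
    proof (rule AE_pmfI)
      fix r assume "r \<in> set_pmf R"
      have "(\<Sum>i\<in>I. indicator {r. P i r} r :: real) = real (card {i\<in>I. P i r})"
        using assms(1) by (simp add: indicator_def of_bool_def sum.If_cases Int_def)
      then show "(\<Sum>i\<in>I. indicator {r. P i r} r) \<le> b"
        using assms(2)[OF \<open>r \<in> set_pmf R\<close>] by simp
    qed
  qed auto
  finally show ?thesis by simp
qed

text \<open>The additional term \<open>N a\<close> makes the induction work: a jump from \<open>a\<close> of
  width \<open>j\<close> costs at most \<open>j\<close> bad indices and gains \<open>j\<close> in \<open>N\<close>.\<close>
lemma card_jumps_le:
  fixes N :: "nat \<Rightarrow> nat"
  assumes mono: "\<And>m. N m \<le> N (Suc m)" and bound: "\<And>m. N m \<le> s"
  shows "card {m \<in> {a..<b}. \<exists>j\<ge>1. N m + j \<le> N (m + j)} + N a \<le> s"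
proof (induction "b - a" arbitrary: a rule: less_induct)
  case less
  define J where "J c = {m \<in> {c..<b}. \<exists>j\<ge>1. N m + j \<le> N (m + j)}" for c
  have fin: "finite (J c)" for c by (simp add: J_def)
  have IH: "card (J c) + N c \<le> s" if "b - c < b - a" for c
    unfolding J_def by (rule less[OF that])
  consider "b \<le> a" | "a < b" "a \<in> J a" | "a < b" "a \<notin> J a" by linarith
  then have "card (J a) + N a \<le> s"
  proof cases
    case 1
    then show ?thesis using bound[of a] by (simp add: J_def)
  next
    case 2
    then obtain j where j: "j \<ge> 1" "N a + j \<le> N (a + j)" by (auto simp: J_def)
    have "J a \<subseteq> {a..<a + j} \<union> J (a + j)" by (auto simp: J_def)
    then have "card (J a) \<le> card ({a..<a + j} \<union> J (a + j))"
      using fin by (intro card_mono) auto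
    also have "\<dots> \<le> j + card (J (a + j))"
      using card_Un_le[of "{a..<a + j}"] by simp
    finally show ?thesis
      using IH[of "a + j"] 2(1) j by linarith
  next
    case 3
    have "c \<in> J (Suc a)" if "c \<in> J a" for c
    proof -
      have "c \<noteq> a" using 3 that by blast
      then show ?thesis using that by (simp add: J_def)
    qed
    then have "J a \<subseteq> J (Suc a)" by blast
    then have "card (J a) \<le> card (J (Suc a))"
      using fin by (intro card_mono) auto
    then show ?thesis
      using IH[of "Suc a"] 3(1) mono[of a] by linarith
  qed
  then show ?case by (simp add: J_def)
qed

text \<open>Positions are filled from the last one down: when \<open>s\<close> elements remain,
  fewer than \<open>s\<close> of them lie in \<open>H s\<close>, so some element can take position
  \<open>s\<close>, and removing it preserves the hypothesis. Positions count from 1 and list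
  indices from 0, hence \<open>Suc j\<close>.\<close>

lemma ex_enumeration_avoiding:
  fixes H :: "nat \<Rightarrow> 'b set"
  assumes "finite P" "\<And>j. j \<ge> 1 \<Longrightarrow> card (P \<inter> H j) < j"
  shows "\<exists>us. set us = P \<and> length us = card P \<and> (\<forall>j<length us. us ! j \<notin> H (Suc j))"
  using assms
proof (induction "card P" arbitrary: P)
  case 0
  then show ?case by (intro exI[of _ "[]"]) auto
next
  case (Suc s)
  have "card (P \<inter> H (Suc s)) < card P"
    using Suc.prems(2)[of "Suc s"] Suc.hyps(2) by simp
  then obtain u where u: "u \<in> P" "u \<notin> H (Suc s)"
    by (metis Int_absorb2 less_irrefl subsetI)
  have "card ((P - {u}) \<inter> H j) < j" if "j \<ge> 1" for j
  proof -
    have "card ((P - {u}) \<inter> H j) \<le> card (P \<inter> H j)"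
      using Suc.prems(1) by (intro card_mono) auto
    then show ?thesis using Suc.prems(2)[OF that] by simp
  qed
  moreover have "s = card (P - {u})" using u Suc.hyps(2) Suc.prems(1) by simp
  ultimately obtain us where us: "set us = P - {u}" "length us = card (P - {u})"
    "\<forall>j<length us. us ! j \<notin> H (Suc j)"
    using Suc.hyps(1)[of "P - {u}"] Suc.prems(1) by blast
  have len: "length us = s" using us(2) \<open>s = card (P - {u})\<close> by simp
  have "(us @ [u]) ! j \<notin> H (Suc j)" if "j < length (us @ [u])" for j
    using us(3) u(2) len that by (cases "j = s") (auto simp: nth_append)
  then show ?case
    using us(1) u(1) len Suc.hyps(2) by (intro exI[of _ "us @ [u]"]) auto
qed

section \<open>Random subsets with independent coordinates\<close>

text \<open>Expanding the product decides for each element whether it belongs to \<open>S\<close>.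
  For \<open>p\<close> in \<open>[0, 1]\<close> the weight of \<open>S\<close> is its probability
  when each element is kept independently with probability \<open>p\<close>; finite weighted sums
  stand in for a product measure.\<close>

lemma sum_binomial_prod:
  fixes p :: real
  assumes "finite V"
  shows "(\<Sum>S\<in>Pow V. p ^ card S * (1 - p) ^ card (V - S) * (\<Prod>u\<in>S. f u))
    = (\<Prod>u\<in>V. 1 - p + p * f u)"
proof -
  have "(\<Prod>u\<in>V. p * f u + (1 - p)) = (\<Sum>S\<in>Pow V. (\<Prod>u\<in>S. p * f u) * (\<Prod>u\<in>V - S. 1 - p))"
    by (rule prod_add[OF assms])
  then show ?thesis by (simp add: prod.distrib algebra_simps)
qed

lemma sum_binomial_weights:
  fixes p :: real
  assumes "finite V"
  shows "(\<Sum>S\<in>Pow V. p ^ card S * (1 - p) ^ card (V - S)) = 1"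
  using sum_binomial_prod[OF assms, of p "\<lambda>_. 1"] by simp

lemma sum_binomial_card:
  fixes p :: real
  assumes "finite V"
  shows "(\<Sum>S\<in>Pow V. p ^ card S * (1 - p) ^ card (V - S) * real (card S)) = p * real (card V)"
  using assms
proof (induction V)
  case (insert v V)
  have im: "card (insert v S) = Suc (card S)" "insert v V - insert v S = V - S"
     "card (insert v V - S) = Suc (card (V - S))" if "S \<in> Pow V" for S
  proof -
    have "finite S" "v \<notin> S" using that insert finite_subset by auto
    then show "card (insert v S) = Suc (card S)" "insert v V - insert v S = V - S"
      using insert by auto
    have "insert v V - S = insert v (V - S)" using \<open>v \<notin> S\<close> by auto
    then show "card (insert v V - S) = Suc (card (V - S))" using insert by auto
  qed
  let ?f = "\<lambda>V S. p ^ card S * (1 - p) ^ card (V - S)"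
  have "(\<Sum>S\<in>Pow (insert v V). ?f (insert v V) S * real (card S))
     = (\<Sum>S\<in>Pow V. ?f (insert v V) S * real (card S))
      + (\<Sum>S\<in>insert v ` Pow V. ?f (insert v V) S * real (card S))"
    unfolding Pow_insert using insert by (intro sum.union_disjoint) auto
  also have "(\<Sum>S\<in>insert v ` Pow V. ?f (insert v V) S * real (card S))
     = (\<Sum>S\<in>Pow V. ?f (insert v V) (insert v S) * real (card (insert v S)))"
    using insert by (intro sum.reindex_cong[of "insert v"]) (auto simp: inj_on_def)
  also have "(\<Sum>S\<in>Pow V. ?f (insert v V) S * real (card S)) +
     (\<Sum>S\<in>Pow V. ?f (insert v V) (insert v S) * real (card (insert v S)))
     = (\<Sum>S\<in>Pow V. ?f V S * real (card S) + p * ?f V S)"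
    unfolding sum.distrib[symmetric]
    by (intro sum.cong refl) (simp only: im, simp add: algebra_simps)
  also have "\<dots> = p * real (card (insert v V))"
    using insert by (simp add: sum.distrib sum_distrib_left[symmetric] sum_binomial_weights algebra_simps)
  finally show ?case .
qed auto

lemma ex_le_binomial_mean:
  fixes p :: real
  assumes "finite V" "0 \<le> p" "p \<le> 1"
    and "(\<Sum>S\<in>Pow V. p ^ card S * (1 - p) ^ card (V - S) * F S) \<le> m"
  shows "\<exists>S\<subseteq>V. F S \<le> m"
proof (rule ccontr)
  assume "\<not> ?thesis"
  then have gt: "m < F S" if "S \<in> Pow V" for S using that by (meson PowD not_le)
  define w where "w S = p ^ card S * (1 - p) ^ card (V - S)" for S
  have w0: "0 \<le> w S" for S using assms by (simp add: w_def)
  have w1: "(\<Sum>S\<in>Pow V. w S) = 1"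
    using sum_binomial_weights[OF assms(1)] by (simp add: w_def)
  \<comment> \<open>Weights can vanish when \<open>p\<close> is 0 or 1, so strictness is claimed
    only at one \<open>S\<close> of nonzero weight.\<close>
  obtain S where S: "S \<in> Pow V" "w S \<noteq> 0"
    using w1 by (metis sum.neutral zero_neq_one)
  have "m = (\<Sum>S\<in>Pow V. w S * m)" by (simp add: w1 sum_distrib_right[symmetric])
  also have "\<dots> < (\<Sum>S\<in>Pow V. w S * F S)"
  proof (rule sum_strict_mono_ex1)
    show "\<forall>S\<in>Pow V. w S * m \<le> w S * F S"
      using gt w0 by (simp add: less_imp_le mult_left_mono)
    have "w S * m < w S * F S"
      using gt[OF S(1)] w0[of S] S(2) by simp
    then show "\<exists>S\<in>Pow V. w S * m < w S * F S" using S(1) by blast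
  qed (use assms in simp)
  finally show False using assms(4) by (simp add: w_def)
qed

text \<open>The quadratic Taylor bound for \<open>exp x\<close>, multiplied by
  \<open>1 - x / 2\<close>, gives \<open>1 + x / 2 - x ^ 3 / 4\<close>, which is at least 1 on
  \<open>[0, 1]\<close>.\<close>

lemma exp_minus_le_linear:
  fixes x :: real
  assumes "0 \<le> x" "x \<le> 1"
  shows "exp (- x) \<le> 1 - x / 2"
proof -
  have "1 + x + x\<^sup>2 / 2 \<le> exp x" using exp_lower_Taylor_quadratic assms(1) by blast
  then have "1 \<le> (1 - x / 2) * exp x"
  proof -
    have "(1 - x/2) * (1 + x + x\<^sup>2/2) \<le> (1 - x/2) * exp x"
      using assms \<open>1 + x + x\<^sup>2 / 2 \<le> exp x\<close> by (intro mult_left_mono) auto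
    moreover have "(1 - x/2) * (1 + x + x\<^sup>2/2) = 1 + x / 2 - x^3/4"
      by (simp add: field_simps power2_eq_square power3_eq_cube)
    moreover have "x ^ 3 \<le> x ^ 1" using assms by (intro power_decreasing) auto
    ultimately show ?thesis using assms by simp
  qed
  then show ?thesis by (simp add: exp_minus field_simps)
qed

lemma prob_fibres_sum:
  fixes R :: "'r pmf"
  assumes "finite S"
  shows "measure_pmf.prob R {r. P r \<and> f r \<in> S} = (\<Sum>u\<in>S. measure_pmf.prob R {r. P r \<and> f r = u})"
proof -
  have "{r. P r \<and> f r \<in> S} = (\<Union>u\<in>S. {r. P r \<and> f r = u})" by auto
  moreover have "measure_pmf.prob R (\<Union>u\<in>S. {r. P r \<and> f r = u})
      = (\<Sum>u\<in>S. measure_pmf.prob R {r. P r \<and> f r = u})"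
    by (rule measure_pmf.finite_measure_finite_Union) (auto simp: assms disjoint_family_on_def)
  ultimately show ?thesis by simp
qed

text \<open>One round of sampling: members of \<open>G\<close> whose list is exhausted survive for free.
  The factor \<open>1 / 2\<close> in \<open>p / 2\<close> comes from linearising \<open>exp\<close> on \<open>[0, 1]\<close>.\<close>
lemma binomial_mean_exp_survivors:
  fixes R :: "'r pmf" and p \<theta> :: real
  assumes V: "finite V" and p: "0 < p" "p \<le> 1" and \<theta>: "0 \<le> \<theta>"
    and us: "\<And>r. r \<in> G \<Longrightarrow> set (us r) \<subseteq> V"
    and bound: "\<And>u. \<theta> * measure_pmf.prob R {r \<in> G. us r \<noteq> [] \<and> hd (us r) = u} \<le> 1"
  shows "(\<Sum>S\<in>Pow V. p ^ card S * (1 - p) ^ card (V - S) *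
      exp (- (\<theta> * measure_pmf.prob R {r \<in> G. us r \<noteq> [] \<longrightarrow> hd (us r) \<in> S})))
    \<le> exp (- (\<theta> * (p / 2) * measure_pmf.prob R G))"
proof -
  define w where "w u = measure_pmf.prob R {r \<in> G. us r \<noteq> [] \<and> hd (us r) = u}" for u
  define w0 where "w0 = measure_pmf.prob R {r \<in> G. us r = []}"
  have split: "measure_pmf.prob R {r \<in> G. us r \<noteq> [] \<longrightarrow> hd (us r) \<in> S} = w0 + (\<Sum>u\<in>S. w u)"
    if "S \<subseteq> V" for S
  proof -
    have "{r \<in> G. us r \<noteq> [] \<longrightarrow> hd (us r) \<in> S}
        = {r \<in> G. us r = []} \<union> {r. (r \<in> G \<and> us r \<noteq> []) \<and> hd (us r) \<in> S}" by auto
    moreover have "measure_pmf.prob R \<dots> = w0 + measure_pmf.prob R {r. (r \<in> G \<and> us r \<noteq> []) \<and> hd (us r) \<in> S}"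
      unfolding w0_def by (rule measure_pmf.finite_measure_Union) auto
    ultimately show ?thesis
      using prob_fibres_sum[OF finite_subset[OF that V], of R "\<lambda>r. r \<in> G \<and> us r \<noteq> []" "\<lambda>r. hd (us r)"]
      by (simp add: w_def conj_assoc)
  qed
  have wn: "0 \<le> w u" "0 \<le> w0" for u by (simp_all add: w_def w0_def)
  have "{r \<in> G. us r \<noteq> [] \<longrightarrow> hd (us r) \<in> V} = G"
    using us by (auto dest!: hd_in_set)
  then have PG: "measure_pmf.prob R G = w0 + (\<Sum>u\<in>V. w u)" using split[of V] by simp
  have "(\<Sum>S\<in>Pow V. p ^ card S * (1 - p) ^ card (V - S) *
      exp (- (\<theta> * measure_pmf.prob R {r \<in> G. us r \<noteq> [] \<longrightarrow> hd (us r) \<in> S})))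
    = (\<Sum>S\<in>Pow V. exp (- (\<theta> * w0)) * (p ^ card S * (1 - p) ^ card (V - S) * (\<Prod>u\<in>S. exp (- (\<theta> * w u)))))"
  proof (intro sum.cong refl)
    fix S assume S: "S \<in> Pow V"
    then have "finite S" using V finite_subset by auto
    then have "exp (- (\<theta> * (w0 + (\<Sum>u\<in>S. w u)))) = exp (- (\<theta> * w0)) * (\<Prod>u\<in>S. exp (- (\<theta> * w u)))"
      by (simp add: exp_sum[symmetric] exp_add[symmetric] sum_negf sum_distrib_left algebra_simps)
    then show "p ^ card S * (1 - p) ^ card (V - S) *
        exp (- (\<theta> * measure_pmf.prob R {r \<in> G. us r \<noteq> [] \<longrightarrow> hd (us r) \<in> S}))
      = exp (- (\<theta> * w0)) * (p ^ card S * (1 - p) ^ card (V - S) * (\<Prod>u\<in>S. exp (- (\<theta> * w u))))"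
      using split[of S] S by simp
  qed
  also have "\<dots> = exp (- (\<theta> * w0)) * (\<Prod>u\<in>V. 1 - p + p * exp (- (\<theta> * w u)))"
    by (simp add: sum_distrib_left[symmetric] sum_binomial_prod[OF V])
  \<comment> \<open>The factor for \<open>w0\<close> is merely weakened, by
    \<open>p / 2 \<le> 1\<close>. The others are linearised by \<open>exp_minus_le_linear\<close>
    and turned back into exponentials by \<open>1 + x \<le> exp x\<close>.\<close>
  also have "\<dots> \<le> exp (- (\<theta> * (p / 2) * w0)) * (\<Prod>u\<in>V. exp (- (\<theta> * (p / 2) * w u)))"
  proof (intro mult_mono prod_mono conjI)
    have "\<theta> * w0 * (p / 2) \<le> \<theta> * w0 * 1" using \<theta> wn p by (intro mult_left_mono) auto
    then show "exp (- (\<theta> * w0)) \<le> exp (- (\<theta> * (p / 2) * w0))" by (simp add: algebra_simps)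
    fix u
    have "exp (- (\<theta> * w u)) \<le> 1 - \<theta> * w u / 2"
      using bound[of u] \<theta> wn(1)[of u] by (intro exp_minus_le_linear) (auto simp: w_def)
    then have "p * exp (- (\<theta> * w u)) \<le> p * (1 - \<theta> * w u / 2)" using p by simp
    moreover have "1 + (- (\<theta> * (p / 2) * w u)) \<le> exp (- (\<theta> * (p / 2) * w u))"
      by (rule exp_ge_add_one_self)
    ultimately show "1 - p + p * exp (- (\<theta> * w u)) \<le> exp (- (\<theta> * (p / 2) * w u))"
      by (simp add: algebra_simps)
  qed (use p in \<open>auto intro!: prod_nonneg add_nonneg_nonneg\<close>)
  also have "\<dots> = exp (- (\<theta> * (p / 2) * measure_pmf.prob R G))"
    unfolding PG using V
    by (simp add: exp_sum[symmetric] exp_add[symmetric] sum_negf sum_distrib_left algebra_simps)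
  finally show ?thesis .
qed

text \<open>Induction on \<open>q\<close>, one sampling round per step: a round keeps the members of
  \<open>G a\<close> whose head is sampled and passes on the tails. Replacing
  \<open>\<theta>\<close> by \<open>\<theta> * (2 / p)\<close> cancels the loss of
  \<open>p / 2\<close> in \<open>binomial_mean_exp_survivors\<close>, so the mean of the exponential
  sum does not grow. The last hypothesis keeps the exponent of each single head at most 1 in every
  round. The price \<open>\<beta>\<close> per coordinate lets one choice of \<open>S\<close> control
  failures and size at once.\<close>

lemma ex_sample_containing_petals:
  fixes R :: "'r pmf" and p \<beta> :: real and \<theta> :: "'c \<Rightarrow> real"
  assumes V: "finite V" and I: "finite I" and p: "0 < p" "p \<le> 1" and \<beta>: "0 \<le> \<beta>"
    and "\<And>a. a \<in> I \<Longrightarrow> 0 \<le> \<theta> a"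
    and "\<And>a r. a \<in> I \<Longrightarrow> r \<in> G a \<Longrightarrow> set (us a r) \<subseteq> V \<and> length (us a r) \<le> q"
    and "\<And>a j u. a \<in> I \<Longrightarrow>
      \<theta> a * (2 / p) ^ Suc j * measure_pmf.prob R {r \<in> G a. j < length (us a r) \<and> us a r ! j = u} \<le> 1"
  shows "\<exists>S\<subseteq>V. real (card {a\<in>I. \<forall>r\<in>G a. \<not> set (us a r) \<subseteq> S}) + \<beta> * real (card S)
    \<le> (\<Sum>a\<in>I. exp (- (\<theta> a * measure_pmf.prob R (G a)))) + \<beta> * (real q * (p * real (card V)))"
  using assms(6-8)
proof (induction q arbitrary: G us \<theta>)
  case 0
  \<comment> \<open>All lists are empty here, so only an empty \<open>G a\<close> fails, and its
    summand is \<open>exp 0 = 1\<close>.\<close>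
  have "{a\<in>I. \<forall>r\<in>G a. \<not> set (us a r) \<subseteq> {}} = {a\<in>I. G a = {}}" using 0(2) by fastforce
  then have "real (card {a\<in>I. \<forall>r\<in>G a. \<not> set (us a r) \<subseteq> {}}) = (\<Sum>a\<in>I. of_bool (G a = {}))"
    using I by (simp add: sum.If_cases of_bool_def Int_def)
  also have "\<dots> \<le> (\<Sum>a\<in>I. exp (- (\<theta> a * measure_pmf.prob R (G a))))"
    by (intro sum_mono) auto
  finally show ?case by (intro exI[of _ "{}"]) auto
next
  case (Suc q)
  define G' where "G' S a = {r \<in> G a. us a r \<noteq> [] \<longrightarrow> hd (us a r) \<in> S}" for S a
  define \<mu> where "\<mu> a = \<theta> a * (2 / p)" for a
  have \<mu>0: "0 \<le> \<mu> a" if "a \<in> I" for a using Suc.prems(1)[OF that] p by (simp add: \<mu>_def)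
  have hd_eq: "us a r \<noteq> [] \<and> hd (us a r) = u \<longleftrightarrow> 0 < length (us a r) \<and> us a r ! 0 = u" for a r u
    by (auto simp: hd_conv_nth)
  let ?w = "\<lambda>S. p ^ card S * (1 - p) ^ card (V - S)"
  have mean: "(\<Sum>S\<in>Pow V. ?w S * exp (- (\<mu> a * measure_pmf.prob R (G' S a))))
      \<le> exp (- (\<theta> a * measure_pmf.prob R (G a)))" if a: "a \<in> I" for a
  proof -
    have "\<mu> a * (p / 2) = \<theta> a" using p by (simp add: \<mu>_def)
    then show ?thesis
      using binomial_mean_exp_survivors[of V p "\<mu> a" "G a" "us a" R] V p \<mu>0[OF a] Suc.prems(2)[OF a]
        Suc.prems(3)[OF a, of 0] unfolding G'_def hd_eq by (simp add: \<mu>_def)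
  qed
  have "(\<Sum>S\<in>Pow V. ?w S * ((\<Sum>a\<in>I. exp (- (\<mu> a * measure_pmf.prob R (G' S a)))) + \<beta> * real (card S)))
      = (\<Sum>a\<in>I. \<Sum>S\<in>Pow V. ?w S * exp (- (\<mu> a * measure_pmf.prob R (G' S a))))
        + \<beta> * (\<Sum>S\<in>Pow V. ?w S * real (card S))"
    by (subst sum.swap) (simp add: sum.distrib sum_distrib_left algebra_simps)
  also have "\<dots> \<le> (\<Sum>a\<in>I. exp (- (\<theta> a * measure_pmf.prob R (G a)))) + \<beta> * (p * real (card V))"
    using mean by (intro add_mono sum_mono) (auto simp: sum_binomial_card[OF V])
  finally have "\<exists>S\<subseteq>V. (\<Sum>a\<in>I. exp (- (\<mu> a * measure_pmf.prob R (G' S a)))) + \<beta> * real (card S)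
      \<le> (\<Sum>a\<in>I. exp (- (\<theta> a * measure_pmf.prob R (G a)))) + \<beta> * (p * real (card V))"
    by (rule ex_le_binomial_mean[OF V less_imp_le[OF p(1)] p(2)])
  then obtain S where S: "S \<subseteq> V" "(\<Sum>a\<in>I. exp (- (\<mu> a * measure_pmf.prob R (G' S a)))) + \<beta> * real (card S)
      \<le> (\<Sum>a\<in>I. exp (- (\<theta> a * measure_pmf.prob R (G a)))) + \<beta> * (p * real (card V))"
    by blast
  have "\<exists>S'\<subseteq>V. real (card {a\<in>I. \<forall>r\<in>G' S a. \<not> set (tl (us a r)) \<subseteq> S'}) + \<beta> * real (card S')
    \<le> (\<Sum>a\<in>I. exp (- (\<mu> a * measure_pmf.prob R (G' S a)))) + \<beta> * (real q * (p * real (card V)))"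
  proof (rule Suc.IH)
    fix a r assume "a \<in> I" "r \<in> G' S a"
    then have "set (us a r) \<subseteq> V" "length (us a r) \<le> Suc q"
      using Suc.prems(2)[of a r] by (auto simp: G'_def)
    then show "set (tl (us a r)) \<subseteq> V \<and> length (tl (us a r)) \<le> q"
      by (cases "us a r") auto
  next
    \<comment> \<open>Position \<open>j\<close> of the tail is position \<open>Suc j\<close> of the
      list; the extra factor \<open>2 / p\<close> in the hypothesis for \<open>Suc j\<close> is the
      one absorbed by \<open>\<mu>\<close>.\<close>
    fix a j u assume a: "a \<in> I"
    have "measure_pmf.prob R {r \<in> G' S a. j < length (tl (us a r)) \<and> tl (us a r) ! j = u}
        \<le> measure_pmf.prob R {r \<in> G a. Suc j < length (us a r) \<and> us a r ! Suc j = u}"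
      by (intro measure_pmf.finite_measure_mono) (auto simp: G'_def nth_tl)
    then have "\<mu> a * (2 / p) ^ Suc j * measure_pmf.prob R {r \<in> G' S a. j < length (tl (us a r)) \<and> tl (us a r) ! j = u}
       \<le> \<mu> a * (2 / p) ^ Suc j * measure_pmf.prob R {r \<in> G a. Suc j < length (us a r) \<and> us a r ! Suc j = u}"
      using \<mu>0[OF a] p by (intro mult_left_mono) auto
    also have "\<dots> \<le> 1" using Suc.prems(3)[OF a, of "Suc j" u] by (simp add: \<mu>_def mult_ac)
    finally show "\<mu> a * (2 / p) ^ Suc j * measure_pmf.prob R {r \<in> G' S a. j < length (tl (us a r)) \<and> tl (us a r) ! j = u} \<le> 1" .
  qed (use \<mu>0 in auto)
  then obtain S' where S': "S' \<subseteq> V"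
    "real (card {a\<in>I. \<forall>r\<in>G' S a. \<not> set (tl (us a r)) \<subseteq> S'}) + \<beta> * real (card S')
    \<le> (\<Sum>a\<in>I. exp (- (\<mu> a * measure_pmf.prob R (G' S a)))) + \<beta> * (real q * (p * real (card V)))"
    by blast
  have "G' S a \<subseteq> G a" for a by (auto simp: G'_def)
  moreover have "set (us a r) \<subseteq> S \<union> S'" if "r \<in> G' S a" "set (tl (us a r)) \<subseteq> S'" for a r
    using that by (cases "us a r") (auto simp: G'_def)
  ultimately have "{a\<in>I. \<forall>r\<in>G a. \<not> set (us a r) \<subseteq> S \<union> S'} \<subseteq> {a\<in>I. \<forall>r\<in>G' S a. \<not> set (tl (us a r)) \<subseteq> S'}"
    by blast
  then have "card {a\<in>I. \<forall>r\<in>G a. \<not> set (us a r) \<subseteq> S \<union> S'} \<le> card {a\<in>I. \<forall>r\<in>G' S a. \<not> set (tl (us a r)) \<subseteq> S'}"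
    using I by (intro card_mono) auto
  moreover have "\<beta> * real (card (S \<union> S')) \<le> \<beta> * (real (card S) + real (card S'))"
    using \<beta> card_Un_le[of S S'] by (intro mult_left_mono) linarith+
  ultimately have "real (card {a\<in>I. \<forall>r\<in>G a. \<not> set (us a r) \<subseteq> S \<union> S'}) + \<beta> * real (card (S \<union> S'))
      \<le> real (card {a\<in>I. \<forall>r\<in>G' S a. \<not> set (tl (us a r)) \<subseteq> S'}) + \<beta> * real (card S') + \<beta> * real (card S)"
    by (simp add: distrib_left)
  also have "\<dots> \<le> (\<Sum>a\<in>I. exp (- (\<mu> a * measure_pmf.prob R (G' S a)))) + \<beta> * real (card S)
      + \<beta> * (real q * (p * real (card V)))"
    using S'(2) by linarith
  also have "\<dots> \<le> (\<Sum>a\<in>I. exp (- (\<theta> a * measure_pmf.prob R (G a)))) + \<beta> * (p * real (card V))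
      + \<beta> * (real q * (p * real (card V)))"
    using S(2) by linarith
  also have "\<dots> = (\<Sum>a\<in>I. exp (- (\<theta> a * measure_pmf.prob R (G a))))
      + \<beta> * (real (Suc q) * (p * real (card V)))"
    by (simp add: algebra_simps)
  finally show ?case
    using S(1) S'(1) by blast
qed

section \<open>Kernels and good levels\<close>

text \<open>The degrees \<open>d\<close> add up to the expected number of queried coordinates, at
  most \<open>q\<close>, which bounds the kernel. At most \<open>q\<close> levels are bad for each
  outcome, so averaging over \<open>M\<close> levels yields \<open>m\<close>. That \<open>m\<close>
  is good is what \<open>ex_enumeration_avoiding\<close> asks of the queries outside the
  kernel.\<close>

lemma ex_level:
  fixes R :: "'r pmf" and Q :: "'r \<Rightarrow> 'v set" and p :: real
  assumes V: "finite V" and p: "0 < p" "p \<le> 1" and q: "q \<ge> 1" and M: "M \<ge> 1"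
    and Q: "\<And>r. r \<in> set_pmf R \<Longrightarrow> Q r \<subseteq> V \<and> card (Q r) \<le> q"
  shows "\<exists>m<M. \<exists>K T us. K \<subseteq> V \<and> real (card K) * p ^ m \<le> 1 \<and> T \<subseteq> set_pmf R
    \<and> measure_pmf.prob R T \<ge> 1 - real q / real M
    \<and> (\<forall>r\<in>T. set (us r) = Q r - K \<and> length (us r) \<le> q)
    \<and> (\<forall>j u. measure_pmf.prob R {r \<in> T. j < length (us r) \<and> us r ! j = u} \<le> real q * p ^ (m + Suc j))"
proof -
  define d where "d v = measure_pmf.prob R {r. v \<in> Q r}" for v
  define K where "K m = {v\<in>V. real q * p ^ m \<le> d v}" for m
  define bad where "bad m r \<longleftrightarrow> (\<exists>j\<ge>1. card (Q r \<inter> K m) + j \<le> card (Q r \<inter> K (m + j)))" for m r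
  have finQ: "finite (Q r)" if "r \<in> set_pmf R" for r using Q[OF that] V finite_subset by blast
  have Kmono: "K m \<subseteq> K (m + j)" for m j
  proof -
    have "real q * p ^ (m + j) \<le> real q * p ^ m"
      using p by (intro mult_left_mono power_decreasing) auto
    then show ?thesis by (auto simp: K_def)
  qed
  have "(\<Sum>v\<in>V. d v) \<le> real q"
    unfolding d_def
  proof (rule sum_prob_le[OF V])
    fix r assume r: "r \<in> set_pmf R"
    have "{i \<in> V. i \<in> Q r} = Q r" using Q[OF r] by auto
    then show "real (card {i \<in> V. i \<in> Q r}) \<le> real q" using Q[OF r] by simp
  qed
  have cardK: "real (card (K m)) * p ^ m \<le> 1" for m
  proof -
    have "real (card (K m)) * (real q * p ^ m) = (\<Sum>v\<in>K m. real q * p ^ m)" by simp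
    also have "\<dots> \<le> (\<Sum>v\<in>K m. d v)" by (intro sum_mono) (auto simp: K_def)
    also have "\<dots> \<le> (\<Sum>v\<in>V. d v)" using V by (intro sum_mono2) (auto simp: K_def d_def)
    finally have "real q * (real (card (K m)) * p ^ m) \<le> real q * 1"
      using \<open>(\<Sum>v\<in>V. d v) \<le> real q\<close> by (simp add: mult_ac)
    then show ?thesis using q by simp
  qed
  have "(\<Sum>m\<in>{0..<M}. measure_pmf.prob R {r. bad m r}) \<le> real q"
  proof (rule sum_prob_le)
    fix r assume r: "r \<in> set_pmf R"
    have "card {m \<in> {0..<M}. bad m r} + card (Q r \<inter> K 0) \<le> q"
      unfolding bad_def
    proof (rule card_jumps_le)
      fix m
      show "card (Q r \<inter> K m) \<le> card (Q r \<inter> K (Suc m))"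
        using finQ[OF r] Kmono[of m 1] by (intro card_mono) auto
      have "card (Q r \<inter> K m) \<le> card (Q r)" using finQ[OF r] by (intro card_mono) auto
      then show "card (Q r \<inter> K m) \<le> q" using Q[OF r] by simp
    qed
    then show "real (card {m \<in> {0..<M}. bad m r}) \<le> real q" by simp
  qed auto
  have "\<exists>m<M. measure_pmf.prob R {r. bad m r} \<le> real q / real M"
  proof (rule ccontr)
    assume "\<not> ?thesis"
    then have "(\<Sum>m\<in>{0..<M}. real q / real M) < (\<Sum>m\<in>{0..<M}. measure_pmf.prob R {r. bad m r})"
      using M by (intro sum_strict_mono) (auto simp: not_le)
    then show False using M \<open>(\<Sum>m\<in>{0..<M}. measure_pmf.prob R {r. bad m r}) \<le> real q\<close> by simp
  qed
  then obtain m where m: "m < M" "measure_pmf.prob R {r. bad m r} \<le> real q / real M" by blast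
  define T where "T = {r \<in> set_pmf R. \<not> bad m r}"
  have "measure_pmf.prob R T = measure_pmf.prob R (- {r. bad m r})"
    unfolding T_def by (rule measure_eq_AE) (auto simp: AE_measure_pmf_iff)
  also have "\<dots> = 1 - measure_pmf.prob R {r. bad m r}"
    using measure_pmf.prob_compl[of "{r. bad m r}" R] by (simp add: Compl_eq_Diff_UNIV)
  finally have probT: "measure_pmf.prob R T \<ge> 1 - real q / real M" using m by simp
  have "\<forall>r\<in>T. \<exists>us. set us = Q r - K m \<and> length us = card (Q r - K m)
      \<and> (\<forall>j<length us. us ! j \<notin> K (m + Suc j))"
  proof
    fix r assume rT: "r \<in> T"
    then have r: "r \<in> set_pmf R" "\<not> bad m r" by (auto simp: T_def)
    show "\<exists>us. set us = Q r - K m \<and> length us = card (Q r - K m) \<and> (\<forall>j<length us. us ! j \<notin> K (m + Suc j))"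
    proof (rule ex_enumeration_avoiding)
      show "finite (Q r - K m)" using finQ[OF r(1)] by simp
      fix j :: nat assume "j \<ge> 1"
      have "Q r \<inter> K (m + j) = (Q r \<inter> K m) \<union> (Q r - K m) \<inter> K (m + j)" using Kmono[of m j] by auto
      then have "card (Q r \<inter> K (m + j)) = card (Q r \<inter> K m) + card ((Q r - K m) \<inter> K (m + j))"
        using finQ[OF r(1)] by (subst card_Un_disjoint[symmetric]) auto
      then show "card ((Q r - K m) \<inter> K (m + j)) < j"
        using r(2) \<open>j \<ge> 1\<close> unfolding bad_def by (metis leI add_le_mono order_refl)
    qed
  qed
  then obtain us where us: "\<And>r. r \<in> T \<Longrightarrow> set (us r) = Q r - K m"
      "\<And>r. r \<in> T \<Longrightarrow> length (us r) = card (Q r - K m)"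
      "\<And>r j. r \<in> T \<Longrightarrow> j < length (us r) \<Longrightarrow> us r ! j \<notin> K (m + Suc j)"
    by metis
  have len: "length (us r) \<le> q" if "r \<in> T" for r
  proof -
    have r: "r \<in> set_pmf R" using that by (auto simp: T_def)
    have "card (Q r - K m) \<le> card (Q r)" using finQ[OF r] by (intro card_mono) auto
    then show ?thesis using us(2)[OF that] Q[OF r] by simp
  qed
  \<comment> \<open>A coordinate at index \<open>j\<close> of some list avoids
    \<open>K (m + Suc j)\<close>, which bounds its degree; any other coordinate gives the empty
    event.\<close>
  have deg: "measure_pmf.prob R {r \<in> T. j < length (us r) \<and> us r ! j = u} \<le> real q * p ^ (m + Suc j)" for j u
  proof (cases "\<exists>r\<in>T. j < length (us r) \<and> us r ! j = u")
    case True
    then obtain r where r: "r \<in> T" "j < length (us r)" "us r ! j = u" by blast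
    then have "u \<in> V" using us(1)[OF r(1)] Q[of r] by (auto simp: T_def dest!: nth_mem)
    then have "d u < real q * p ^ (m + Suc j)" using us(3)[OF r(1,2)] r(3) by (auto simp: K_def)
    moreover have "measure_pmf.prob R {r \<in> T. j < length (us r) \<and> us r ! j = u} \<le> d u"
      unfolding d_def using us(1) by (intro measure_pmf.finite_measure_mono) (auto dest!: nth_mem)
    ultimately show ?thesis by simp
  next
    case False
    then have "{r \<in> T. j < length (us r) \<and> us r ! j = u} = {}" by blast
    then show ?thesis using p by (simp only:) simp
  qed
  have "K m \<subseteq> V" "T \<subseteq> set_pmf R" by (auto simp: K_def T_def)
  then show ?thesis using m(1) cardK[of m] probT us(1) len deg by blast
qed

section \<open>Perfect completeness and counting of codewords\<close>

lemma card_le_of_inj_restrict: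
  fixes c :: "'b \<Rightarrow> nat \<Rightarrow> 'a::finite"
  assumes "finite S" "inj_on (\<lambda>x. restrict (c x) S) D"
  shows "card D \<le> CARD('a) ^ card S"
proof -
  have "card D \<le> card (S \<rightarrow>\<^sub>E (UNIV :: 'a set))"
    using assms by (intro card_inj_on_le) (auto simp: finite_PiE)
  then show ?thesis using assms(1) by (simp add: card_PiE)
qed

text \<open>An event of probability 1 under a \<open>pmf\<close> contains the whole support.\<close>

lemma decoder_complete:
  assumes "relaxed_decoder k n q \<delta> \<sigma> C R B" "i < k" "length x = k" "r \<in> set_pmf R"
  shows "run (B i r) (C x) = Some (x ! i)"
proof -
  have "measure_pmf.prob R {r. run (B i r) (C x) = Some (x ! i)} = 1"
    using assms unfolding relaxed_decoder_def by blast
  then have "AE r in measure_pmf R. r \<in> {r. run (B i r) (C x) = Some (x ! i)}"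
    by (subst (asm) measure_pmf.prob_eq_1) auto
  then show ?thesis using assms(4) by (simp add: AE_measure_pmf_iff)
qed

lemma decoder_code_inj:
  assumes "relaxed_decoder k n q \<delta> \<sigma> C R B" "length x = k" "length y = k" "C x = C y"
  shows "x = y"
proof (rule nth_equalityI)
  fix i assume "i < length x"
  moreover obtain r where "r \<in> set_pmf R" using set_pmf_not_empty[of R] by blast
  ultimately show "x ! i = y ! i"
    using decoder_complete[OF assms(1), of i x r] decoder_complete[OF assms(1), of i y r] assms(2-4)
    by simp
qed (use assms in simp)

lemma log_bound_of_pow_le:
  fixes t :: real
  assumes "2 ^ a \<le> c ^ b" "c \<ge> (1 :: nat)"
  shows "real a \<le> real b * log 2 (real c)"
proof -
  have "real (2 ^ a) \<le> real (c ^ b)" using assms(1) by (simp only: of_nat_le_iff)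
  then have "2 ^ a \<le> real c ^ b" by simp
  then have "log 2 (2 ^ a) \<le> log 2 (real c ^ b)" by (intro log_mono) auto
  then show ?thesis using assms(2) by (simp add: log_nat_power)
qed

text \<open>Perfect completeness makes the code injective. This trivial bound settles the case of a
  sampling probability above 1 and later excludes \<open>n = 0\<close>.\<close>

lemma code_dimension_le:
  fixes C :: "bool list \<Rightarrow> 'a::finite list"
  assumes dec: "relaxed_decoder k n q \<delta> \<sigma> C R B"
    and lenC: "\<And>x. length x = k \<Longrightarrow> length (C x) = n"
  shows "real k \<le> real n * log 2 (real CARD('a))"
proof -
  define X where "X = {x :: bool list. length x = k}"
  have "inj_on (\<lambda>x. restrict ((!) (C x)) {..<n}) X"
  proof (rule inj_onI)
    fix x y assume xy: "x \<in> X" "y \<in> X" and eq: "restrict ((!) (C x)) {..<n} = restrict ((!) (C y)) {..<n}"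
    have "C x = C y"
    proof (rule nth_equalityI)
      fix j assume "j < length (C x)"
      then show "C x ! j = C y ! j" using fun_cong[OF eq, of j] lenC xy by (simp add: X_def)
    qed (use xy lenC in \<open>simp add: X_def\<close>)
    then show "x = y" using decoder_code_inj[OF dec] xy by (simp add: X_def)
  qed
  from card_le_of_inj_restrict[OF _ this]
  have "2 ^ k \<le> CARD('a) ^ n"
    using card_lists_length_eq[of "UNIV :: bool set" k] by (simp add: X_def)
  then show ?thesis by (rule log_bound_of_pow_le) simp
qed

section \<open>The sampling bound with free parameters\<close>

text \<open>\<open>kernel\<close> keeps a codeword overwritten on any kernel within distance
  \<open>\<delta>\<close>. \<open>\<epsilon>\<close> is a lower bound for the probability that the
  level is good and the answer is not wrong. \<open>A\<close> makes the exponential term of a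
  message, an index and a kernel assignment at most \<open>1 / (4 * k * N ^ card (K i))\<close>,
  ready for a union bound.\<close>

lemma nonadaptive_decoder_bound:
  fixes C :: "bool list \<Rightarrow> 'a::finite list" and \<sigma> \<delta> \<epsilon> p0 A :: real
  assumes dec: "relaxed_decoder k n q \<delta> \<sigma> C R B" and nonad: "nonadaptive k n R B"
    and lenC: "\<And>x. length x = k \<Longrightarrow> length (C x) = n"
    and k: "k \<ge> 2" and q: "q \<ge> 1" and n: "n \<ge> 1" and card2: "CARD('a) \<ge> 2"
    and M: "M \<ge> 1" and p0: "0 < p0" "p0 \<le> 1"
    and \<epsilon>: "0 < \<epsilon>" "\<epsilon> \<le> 1" "\<epsilon> \<le> \<sigma> - real q / real M"
    and kernel: "1 / p0 ^ (M - 1) \<le> \<delta> * real n"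
    and A: "A = 2 * real q * (ln (real CARD('a)) + ln (4 * real k)) / \<epsilon>"
  shows "real k \<le> 4 * real q * A * p0 * real n * log 2 (real CARD('a))"
proof -
  define N where "N = real CARD('a)"
  define X where "X = {x :: bool list. length x = k}"
  define Z where "Z = real (card X)"
  have Z: "Z = 2 ^ k" using card_lists_length_eq[of "UNIV :: bool set" k] by (simp add: X_def Z_def)
  have finX: "finite X" using finite_lists_length_eq[of "UNIV :: bool set" k] by (simp add: X_def)
  have N2: "N \<ge> 2" using card2 by (simp add: N_def)
  have "1 \<le> ln (4 * real k)"
  proof -
    have "exp 1 \<le> (3 :: real)" by (rule exp_le)
    then have "exp 1 \<le> 4 * real k" using k by linarith
    then show ?thesis using k by (subst ln_ge_iff) auto
  qed
  then have "1 \<le> ln N + ln (4 * real k)" using ln_ge_zero[of N] N2 by linarith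
  moreover have "\<epsilon> \<le> real q" using \<epsilon>(2) q by linarith
  ultimately have "\<epsilon> * 1 \<le> real q * (ln N + ln (4 * real k))"
    using q \<epsilon> by (intro mult_mono) auto
  then have A2: "A \<ge> 2" using \<epsilon> by (simp add: A N_def field_simps)
  have L0: "0 \<le> log 2 N" using N2 by simp
  define p where "p = A * p0"
  have p: "0 < p" using A2 p0 by (simp add: p_def)
  show ?thesis
  proof (cases "p \<le> 1")
    case False
    \<comment> \<open>For \<open>p > 1\<close> the trivial dimension bound suffices.\<close>
    have "1 * 1 \<le> (4 * real q) * p" using False q by (intro mult_mono) auto
    then have "real n * log 2 N * 1 \<le> real n * log 2 N * (4 * real q * p)"
      using L0 by (intro mult_left_mono) auto
    then show ?thesis using code_dimension_le[OF dec lenC] by (simp add: N_def p_def mult_ac)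
  next
    case p1: True
    \<comment> \<open>By non-adaptivity any word of length \<open>n\<close> reveals the query set;
      the codeword of the zero message is one.\<close>
    define w0 where "w0 = C (replicate k False)"
    define Q where "Q i r = set (queries (B i r) w0)" for i r
    have w0: "length w0 = n" using lenC by (simp add: w0_def)
    have Qbound: "Q i r \<subseteq> {..<n} \<and> card (Q i r) \<le> q" if "i < k" "r \<in> set_pmf R" for i r
    proof -
      have "length (queries (B i r) w0) \<le> q" "set (queries (B i r) w0) \<subseteq> {..<n}"
        using dec w0 that unfolding relaxed_decoder_def by blast+
      then show ?thesis using card_length[of "queries (B i r) w0"] by (simp add: Q_def)
    qed
    have Qeq: "set (queries (B i r) w) = Q i r" if "i < k" "r \<in> set_pmf R" "length w = n" for i r w
      using nonad w0 that unfolding nonadaptive_def Q_def by metis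
    define level_data where "level_data i m K T us \<longleftrightarrow> m < M \<and> K \<subseteq> {..<n} \<and> real (card K) * p0 ^ m \<le> 1
      \<and> T \<subseteq> set_pmf R \<and> measure_pmf.prob R T \<ge> 1 - real q / real M
      \<and> (\<forall>r\<in>T. set (us r) = Q i r - K \<and> length (us r) \<le> q)
      \<and> (\<forall>j u. measure_pmf.prob R {r \<in> T. j < length (us r) \<and> us r ! j = u} \<le> real q * p0 ^ (m + Suc j))"
      for i m K T us
    have "\<exists>m K T us. level_data i m K T us" if "i < k" for i
      using ex_level[of "{..<n}" p0 q M R "Q i"] p0 q M Qbound[OF that]
      unfolding level_data_def by blast
    then obtain m K T us where "\<And>i. i < k \<Longrightarrow> level_data i (m i) (K i) (T i) (us i)"
      by metis
    then have level: "\<And>i. i < k \<Longrightarrow> m i < M"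
      "\<And>i. i < k \<Longrightarrow> K i \<subseteq> {..<n}"
      "\<And>i. i < k \<Longrightarrow> real (card (K i)) * p0 ^ m i \<le> 1"
      "\<And>i. i < k \<Longrightarrow> T i \<subseteq> set_pmf R"
      "\<And>i. i < k \<Longrightarrow> measure_pmf.prob R (T i) \<ge> 1 - real q / real M"
      "\<And>i r. i < k \<Longrightarrow> r \<in> T i \<Longrightarrow> set (us i r) = Q i r - K i \<and> length (us i r) \<le> q"
      "\<And>i j u. i < k \<Longrightarrow> measure_pmf.prob R {r \<in> T i. j < length (us i r) \<and> us i r ! j = u}
          \<le> real q * p0 ^ (m i + Suc j)"
      unfolding level_data_def by blast+
    define W where "W x i \<kappa> = map (\<lambda>v. if v \<in> K i then \<kappa> v else C x ! v) [0..<n]"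
      for x i and \<kappa> :: "nat \<Rightarrow> 'a"
    define G where "G a = (case a of (x, i, \<kappa>) \<Rightarrow> {r \<in> T i. run (B i r) (W x i \<kappa>) \<in> {Some (x ! i), None}})" for a
    define vs where "vs a = us (fst (snd a))" for a :: "bool list \<times> nat \<times> (nat \<Rightarrow> 'a)"
    define \<theta> where "\<theta> a = A / (2 * real q * p0 ^ m (fst (snd a)))" for a :: "bool list \<times> nat \<times> (nat \<Rightarrow> 'a)"
    \<comment> \<open>All assignments \<open>\<kappa>\<close> to the kernel are included, so that
      \<open>S\<close> can be fixed before the second message, whose codeword supplies
      \<open>\<kappa>\<close>.\<close>
    define I where "I = (SIGMA x:X. SIGMA i:{..<k}. K i \<rightarrow>\<^sub>E (UNIV :: 'a set))"
    have finK: "finite (K i)" if "i < k" for i using level(2)[OF that] finite_subset by blast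
    have finI: "finite I" unfolding I_def using finX finK by (auto intro!: finite_SigmaI finite_PiE)
    have lenW: "length (W x i \<kappa>) = n" for x i \<kappa> by (simp add: W_def)
    have distW: "rel_hamming_dist (W x i \<kappa>) (C x) \<le> \<delta>" if "i < k" for x i \<kappa>
    proof -
      have "card {j. j < n \<and> W x i \<kappa> ! j \<noteq> C x ! j} \<le> card (K i)"
        using finK[OF that] by (intro card_mono) (auto simp: W_def split: if_splits)
      then have "real (card {j. j < n \<and> W x i \<kappa> ! j \<noteq> C x ! j}) \<le> real (card (K i))" by simp
      also have "\<dots> \<le> 1 / p0 ^ m i" using level(3)[OF that] p0 by (simp add: field_simps)
      also have "\<dots> \<le> 1 / p0 ^ (M - 1)"
        using p0 level(1)[OF that] by (intro divide_left_mono power_decreasing) auto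
      also have "\<dots> \<le> \<delta> * real n" by (rule kernel)
      finally show ?thesis
        using n by (simp add: rel_hamming_dist_def lenW field_simps)
    qed
    have probG: "measure_pmf.prob R (G (x, i, \<kappa>)) \<ge> \<epsilon>" if "i < k" "x \<in> X" for x i \<kappa>
    proof -
      let ?E = "{r. run (B i r) (W x i \<kappa>) \<in> {Some (x ! i), None}}"
      have "measure_pmf.prob R ?E \<ge> \<sigma>"
        using dec that distW[OF that(1)] lenW unfolding relaxed_decoder_def X_def by blast
      \<comment> \<open>Inclusion-exclusion: events of probability at least \<open>1 - q / M\<close>
        and \<open>\<sigma>\<close> meet with probability at least
        \<open>\<sigma> - q / M\<close>.\<close>
      moreover have "measure_pmf.prob R (T i) + measure_pmf.prob R ?E
          = measure_pmf.prob R (T i \<union> ?E) + measure_pmf.prob R (T i \<inter> ?E)"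
        using measure_Un3[of "T i" "measure_pmf R" ?E] by (simp add: measure_pmf.fmeasurable_eq_sets)
      moreover have "measure_pmf.prob R (T i \<union> ?E) \<le> 1" by simp
      moreover have "measure_pmf.prob R (G (x, i, \<kappa>)) = measure_pmf.prob R (T i \<inter> ?E)"
        by (intro arg_cong[where f = "measure_pmf.prob R"]) (auto simp: G_def)
      ultimately show ?thesis using level(5)[OF that(1)] \<epsilon>(3) by linarith
    qed
    \<comment> \<open>Price per sampled coordinate, chosen so that the expected total price is \<open>Z / 4\<close>.\<close>
    define \<beta> where "\<beta> = Z / (4 * real q * p * real n)"
    have \<beta>0: "0 < \<beta>" using Z q p n by (simp add: \<beta>_def)
    have "\<exists>S\<subseteq>{..<n}. real (card {a\<in>I. \<forall>r\<in>G a. \<not> set (vs a r) \<subseteq> S}) + \<beta> * real (card S)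
      \<le> (\<Sum>a\<in>I. exp (- (\<theta> a * measure_pmf.prob R (G a)))) + \<beta> * (real q * (p * real (card {..<n})))"
    proof (rule ex_sample_containing_petals)
      fix a assume a: "a \<in> I"
      obtain x i \<kappa> where a_eq: "a = (x, i, \<kappa>)" by (cases a)
      have i: "i < k" using a by (auto simp: a_eq I_def)
      show "0 \<le> \<theta> a" using A2 p0 by (simp add: \<theta>_def)
      show "set (vs a r) \<subseteq> {..<n} \<and> length (vs a r) \<le> q" if "r \<in> G a" for r
      proof -
        have r: "r \<in> T i" using that by (simp add: G_def a_eq)
        then show ?thesis
          using level(6)[OF i r] level(4)[OF i] Qbound[OF i, of r] by (auto simp: vs_def a_eq)
      qed
      fix j u
      have "measure_pmf.prob R {r \<in> G a. j < length (vs a r) \<and> vs a r ! j = u}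
        \<le> measure_pmf.prob R {r \<in> T i. j < length (us i r) \<and> us i r ! j = u}"
        by (intro measure_pmf.finite_measure_mono) (auto simp: G_def vs_def a_eq)
      also have "\<dots> \<le> real q * p0 ^ (m i + Suc j)" by (rule level(7)[OF i])
      finally have "\<theta> a * (2 / p) ^ Suc j * measure_pmf.prob R {r \<in> G a. j < length (vs a r) \<and> vs a r ! j = u}
        \<le> \<theta> a * (2 / p) ^ Suc j * (real q * p0 ^ (m i + Suc j))"
        using A2 p0 p by (intro mult_left_mono) (auto simp: \<theta>_def)
      \<comment> \<open>As \<open>p = A * p0\<close>, all powers of \<open>p0\<close> cancel; the 2
        in the denominator of \<open>\<theta>\<close> makes the value exactly 1 at
        \<open>j = 0\<close>.\<close>
      also have "\<dots> = (2 / A) ^ j"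
        using A2 p0 q by (simp add: \<theta>_def a_eq p_def power_divide power_mult_distrib power_add field_simps)
      also have "\<dots> \<le> 1" using A2 by (intro power_le_one) auto
      finally show "\<theta> a * (2 / p) ^ Suc j * measure_pmf.prob R {r \<in> G a. j < length (vs a r) \<and> vs a r ! j = u} \<le> 1" .
    qed (use finI p p1 \<beta>0 in auto)
    then obtain S where S: "S \<subseteq> {..<n}" "real (card {a\<in>I. \<forall>r\<in>G a. \<not> set (vs a r) \<subseteq> S}) + \<beta> * real (card S)
      \<le> (\<Sum>a\<in>I. exp (- (\<theta> a * measure_pmf.prob R (G a)))) + \<beta> * (real q * (p * real n))"
      by auto
    have exp_bound: "exp (- (\<theta> (x, i, \<kappa>) * measure_pmf.prob R (G (x, i, \<kappa>)))) \<le> 1 / (4 * real k * N ^ card (K i))"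
      if "x \<in> X" "i < k" for x i \<kappa>
    proof -
      have "real (card (K i)) * ln N * p0 ^ m i + ln (4 * real k) * p0 ^ m i \<le> 1 * ln N + ln (4 * real k) * 1"
      proof (rule add_mono)
        show "real (card (K i)) * ln N * p0 ^ m i \<le> 1 * ln N"
          using mult_right_mono[OF level(3)[OF that(2)], of "ln N"] N2 by (simp add: mult_ac)
        show "ln (4 * real k) * p0 ^ m i \<le> ln (4 * real k) * 1"
          using p0 \<open>1 \<le> ln (4 * real k)\<close> by (intro mult_left_mono power_le_one) auto
      qed
      then have "real (card (K i)) * ln N + ln (4 * real k) \<le> (ln N + ln (4 * real k)) / p0 ^ m i"
        using p0 by (subst pos_le_divide_eq) (auto simp: distrib_right)
      also have "\<dots> = \<theta> (x, i, \<kappa>) * \<epsilon>"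
      proof -
        have "A * \<epsilon> = (2 * real q) * (ln N + ln (4 * real k))" using \<epsilon> by (simp add: A N_def)
        then have "\<theta> (x, i, \<kappa>) * \<epsilon> = (2 * real q) * (ln N + ln (4 * real k)) / ((2 * real q) * p0 ^ m i)"
          by (simp add: \<theta>_def)
        then show ?thesis using q by (simp only: mult_divide_mult_cancel_left_if) simp
      qed
      also have "\<dots> \<le> \<theta> (x, i, \<kappa>) * measure_pmf.prob R (G (x, i, \<kappa>))"
        using probG[OF that(2,1)] A2 p0 by (intro mult_left_mono) (auto simp: \<theta>_def)
      finally have "exp (- (\<theta> (x, i, \<kappa>) * measure_pmf.prob R (G (x, i, \<kappa>))))
          \<le> exp (- (real (card (K i)) * ln N + ln (4 * real k)))" by simp
      also have "\<dots> = 1 / (4 * real k * N ^ card (K i))"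
      proof -
        have "exp (real (card (K i)) * ln N) = N ^ card (K i)"
          using N2 by (subst exp_of_nat_mult) simp
        moreover have "exp (ln (4 * real k)) = 4 * real k" using k by (subst exp_ln) auto
        ultimately show ?thesis
          by (simp only: exp_minus exp_add inverse_eq_divide mult.commute[of "N ^ card (K i)"])
      qed
      finally show ?thesis .
    qed
    have "(\<Sum>a\<in>I. exp (- (\<theta> a * measure_pmf.prob R (G a))))
      \<le> (\<Sum>(x, i, \<kappa>)\<in>I. 1 / (4 * real k * N ^ card (K i)))"
    proof (rule sum_mono)
      fix a assume a: "a \<in> I"
      obtain x i \<kappa> where a_eq: "a = (x, i, \<kappa>)" by (cases a)
      have "x \<in> X" "i < k" using a by (auto simp: a_eq I_def)
      then show "exp (- (\<theta> a * measure_pmf.prob R (G a))) \<le> (case a of (x, i, \<kappa>) \<Rightarrow> 1 / (4 * real k * N ^ card (K i)))"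
        unfolding a_eq prod.case by (rule exp_bound)
    qed
    also have "\<dots> = (\<Sum>x\<in>X. \<Sum>(i, \<kappa>)\<in>(SIGMA i:{..<k}. K i \<rightarrow>\<^sub>E (UNIV :: 'a set)). 1 / (4 * real k * N ^ card (K i)))"
      unfolding I_def using finX finK by (intro sum.Sigma[symmetric]) (auto intro!: finite_SigmaI finite_PiE)
    also have "\<dots> = (\<Sum>x\<in>X. \<Sum>i<k. \<Sum>\<kappa>\<in>K i \<rightarrow>\<^sub>E (UNIV :: 'a set). 1 / (4 * real k * N ^ card (K i)))"
      using finK by (intro sum.cong refl sum.Sigma[symmetric]) (auto intro!: finite_PiE)
    \<comment> \<open>The number of assignments cancels \<open>N ^ card (K i)\<close>; the
      \<open>k\<close> indices then leave 1/4 per message.\<close>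
    also have "\<dots> = (\<Sum>x\<in>X. \<Sum>i<k. 1 / (4 * real k))"
    proof (intro sum.cong refl)
      fix i assume "i \<in> {..<k}"
      then have "real (card (K i \<rightarrow>\<^sub>E (UNIV :: 'a set))) = N ^ card (K i)"
        using finK by (simp add: card_PiE N_def)
      then show "(\<Sum>\<kappa>\<in>K i \<rightarrow>\<^sub>E (UNIV :: 'a set). 1 / (4 * real k * N ^ card (K i))) = 1 / (4 * real k)"
        using N2 by simp
    qed
    also have "\<dots> = Z / 4" using k by (simp add: Z_def)
    finally have sumexp: "(\<Sum>a\<in>I. exp (- (\<theta> a * measure_pmf.prob R (G a)))) \<le> Z / 4" .
    have \<beta>q: "\<beta> * (real q * (p * real n)) = Z / 4" using q p n by (simp add: \<beta>_def)
    define F where "F = {a\<in>I. \<forall>r\<in>G a. \<not> set (vs a r) \<subseteq> S}"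
    have finF: "finite F" using finI by (simp add: F_def)
    have half: "real (card F) + \<beta> * real (card S) \<le> Z / 2"
      using S(2) sumexp \<beta>q by (simp add: F_def)
    \<comment> \<open>Each failing triple spoils one message, so at least half of the messages
      remain in \<open>D\<close>.\<close>
    define D where "D = X - fst ` F"
    have "inj_on (\<lambda>x. restrict ((!) (C x)) S) D"
    proof (rule inj_onI, rule ccontr)
      fix x y assume xy: "x \<in> D" "y \<in> D" "x \<noteq> y"
        and eq: "restrict ((!) (C x)) S = restrict ((!) (C y)) S"
      have len: "length x = k" "length y = k" using xy by (auto simp: D_def X_def)
      then obtain i where i: "i < k" "x ! i \<noteq> y ! i" using xy(3) by (auto simp: list_eq_iff_nth_eq)
      \<comment> \<open>Queries in the kernel are answered from \<open>C y\<close> through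
        \<open>\<kappa>\<close>; the others lie in \<open>S\<close>, where the codewords agree. So
        the decoder outputs \<open>y ! i\<close>, although \<open>r\<close> in \<open>G\<close>
        allows only \<open>x ! i\<close> or \<open>None\<close>.\<close>
      define \<kappa> where "\<kappa> = restrict ((!) (C y)) (K i)"
      have "(x, i, \<kappa>) \<in> I" using i len by (auto simp: I_def X_def \<kappa>_def)
      moreover have "(x, i, \<kappa>) \<notin> F" using xy(1) by (force simp: D_def)
      ultimately obtain r where r: "r \<in> G (x, i, \<kappa>)" "set (vs (x, i, \<kappa>) r) \<subseteq> S"
        by (auto simp: F_def)
      have rT: "r \<in> T i" using r by (simp add: G_def)
      then have rR: "r \<in> set_pmf R" using level(4)[OF i(1)] by blast
      have "run (B i r) (W x i \<kappa>) = run (B i r) (C y)"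
      proof (rule run_cong)
        fix v assume "v \<in> set (queries (B i r) (W x i \<kappa>))"
        then have v: "v \<in> Q i r" using Qeq[OF i(1) rR lenW] by simp
        then have vn: "v < n" using Qbound[OF i(1) rR] by auto
        show "W x i \<kappa> ! v = C y ! v"
        proof (cases "v \<in> K i")
          case True
          then show ?thesis using vn by (simp add: W_def \<kappa>_def)
        next
          case False
          then have "v \<in> S" using level(6)[OF i(1) rT] v r(2) by (auto simp: vs_def)
          then have "C x ! v = C y ! v" using fun_cong[OF eq, of v] by simp
          then show ?thesis using vn False by (simp add: W_def)
        qed
      qed
      then have "run (B i r) (W x i \<kappa>) = Some (y ! i)"
        using decoder_complete[OF dec i(1) len(2) rR] by simp
      then show False using r(1) i(2) by (simp add: G_def)
    qed
    from card_le_of_inj_restrict[OF _ this]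
    have cardD: "card D \<le> CARD('a) ^ card S" using S(1) finite_subset by blast
    have "card (fst ` F) \<le> card F" using finF by (rule card_image_le)
    moreover have "0 \<le> \<beta> * real (card S)" using \<beta>0 by simp
    ultimately have "real (card (fst ` F)) \<le> Z / 2" using half by linarith
    moreover have "card X - card (fst ` F) \<le> card D"
      unfolding D_def using finF by (intro diff_card_le_card_Diff) auto
    ultimately have "Z / 2 \<le> real (card D)" by (simp add: Z_def)
    moreover have "Z / 2 = 2 ^ (k - 1)" using k unfolding Z by (cases k) auto
    ultimately have "real (2 ^ (k - 1)) \<le> real (card D)" by simp
    then have "2 ^ (k - 1) \<le> card D" by (simp only: of_nat_le_iff)
    then have "2 ^ (k - 1) \<le> CARD('a) ^ card S" using cardD by (rule le_trans)
    then have "real (k - 1) \<le> real (card S) * log 2 N"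
      unfolding N_def by (rule log_bound_of_pow_le) simp
    moreover have "real (card S) \<le> 2 * real q * p * real n"
    proof -
      have "\<beta> * real (card S) \<le> \<beta> * (2 * real q * p * real n)" using half \<beta>q by (simp add: algebra_simps)
      then show ?thesis using \<beta>0 by simp
    qed
    then have "real (card S) * log 2 N \<le> 2 * real q * p * real n * log 2 N"
      using L0 by (intro mult_right_mono)
    \<comment> \<open>Half of the messages cost one bit; for \<open>k \<ge> 2\<close> this is paid
      by a factor 2.\<close>
    moreover have "real k \<le> 2 * real (k - 1)" using k by (simp add: of_nat_diff)
    ultimately have "real k \<le> 2 * (2 * real q * p * real n * log 2 N)" by linarith
    then show ?thesis by (simp add: N_def p_def mult_ac)
  qed
qed

section \<open>Choice of parameters and the final estimate\<close>

text \<open>Here \<open>y = q / \<sigma>\<close>. The bound \<open>M \<le> 2 * y\<close> makes the kernels smaller than \<open>\<delta> * n\<close>; the natural choice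
  \<open>\<lceil>y\<rceil> + 1\<close> violates it for \<open>1 < y < 3 / 2\<close>.\<close>
lemma ex_number_of_levels:
  fixes y :: real
  assumes "y \<ge> 1"
  obtains M :: nat where "M \<ge> 1" "real M \<le> 2 * y" "real M \<le> real_of_int \<lceil>y\<rceil> + 1" "1 / (4 * y) \<le> 1 - y / real M"
proof (cases "y < 3 / 2")
  case True
  have "1 / (4 * y) \<le> 1 / 4" using assms by (intro divide_left_mono) auto
  moreover have "1 \<le> real_of_int \<lceil>y\<rceil>" using assms le_of_int_ceiling[of y] by linarith
  ultimately have "1 / (4 * y) \<le> 1 - y / 2" "2 \<le> 2 * y" "2 \<le> real_of_int \<lceil>y\<rceil> + 1"
    using True assms by linarith+
  then show ?thesis using that[of 2] by simp
next
  case False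
  define M where "M = nat \<lceil>y\<rceil> + 1"
  have c: "y \<le> real_of_int \<lceil>y\<rceil>" "real_of_int \<lceil>y\<rceil> < y + 1" by linarith+
  have M: "real M = real_of_int \<lceil>y\<rceil> + 1" using assms c by (simp add: M_def)
  \<comment> \<open>For \<open>3 / 2 \<le> y \<le> 2\<close> this is \<open>M \<le> 3\<close>; for
    larger \<open>y\<close> it is \<open>M < y + 2\<close>.\<close>
  have "real M \<le> 2 * y"
  proof (cases "y \<le> 2")
    case True
    then have "\<lceil>y\<rceil> \<le> 2" by (simp add: ceiling_le_iff)
    then have "real_of_int \<lceil>y\<rceil> \<le> 2" by linarith
    then show ?thesis using False M by linarith
  next
    case False
    then show ?thesis using M c by linarith
  qed
  moreover have "y / real M \<le> y / (y + 1)" 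
  proof (rule divide_left_mono)
    show "y + 1 \<le> real M" using M c(1) by linarith
    then show "0 < real M * (y + 1)" using assms by (intro mult_pos_pos) linarith+
  qed (use assms in simp)
  moreover have "1 - y / (y + 1) = 1 / (y + 1)" using assms by (simp add: field_simps)
  moreover have "1 / (4 * y) \<le> 1 / (y + 1)" using assms by (intro divide_left_mono) auto
  ultimately have "1 / (4 * y) \<le> 1 - y / real M" by linarith
  moreover have "M \<ge> 1" by (simp add: M_def)
  ultimately show ?thesis using that[of M] M \<open>real M \<le> 2 * y\<close> by simp
qed

text \<open>A codeword is at distance 0 from itself, so soundness bounds \<open>\<sigma>\<close> by
  a probability.\<close>

lemma decoder_soundness_le_1:
  assumes "relaxed_decoder k n q \<delta> \<sigma> C R B" "0 < k" "0 \<le> \<delta>"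
    and "\<And>x. length x = k \<Longrightarrow> length (C x) = n"
  shows "\<sigma> \<le> 1"
proof -
  let ?x = "replicate k False"
  have "rel_hamming_dist (C ?x) (C ?x) \<le> \<delta>" using assms(3) by (simp add: rel_hamming_dist_def)
  then have "\<sigma> \<le> measure_pmf.prob R {r. run (B 0 r) (C ?x) \<in> {Some (?x ! 0), None}}"
    using assms unfolding relaxed_decoder_def by (metis length_replicate)
  then show ?thesis using measure_pmf.prob_le_1 order_trans by blast
qed

text \<open>The factor \<open>32 * q ^ 3 / \<sigma>^2\<close> is \<open>4 * q\<close> times the
  \<open>2 * q / \<epsilon>\<close> from \<open>A\<close>, with
  \<open>\<epsilon> = \<sigma>^2 / (4 * q)\<close>.\<close>

lemma le_powr_of_decoder:
  fixes C :: "bool list \<Rightarrow> 'a::finite list" and \<sigma> \<delta> :: real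
  assumes \<sigma>: "0 < \<sigma>" "\<sigma> \<le> 1"
    and \<delta>: "\<delta> > real n powr (- (\<sigma> / (2 * real q)))"
    and lenC: "\<And>x. length x = k \<Longrightarrow> length (C x) = n"
    and dec: "relaxed_decoder k n q \<delta> \<sigma> C R B" and nonad: "nonadaptive k n R B"
    and k: "k \<ge> 32" and q: "q \<ge> 1" and n: "n \<ge> 1" and card2: "CARD('a) \<ge> 2"
  shows "\<sigma>^2 * real k \<le> 32 * real q ^ 3 * (log 2 (real CARD('a)))^2 * (log 2 (real k))^2
    * real n powr (1 - 1 / (real_of_int \<lceil>real q / \<sigma>\<rceil> + 1))"
proof -
  define y where "y = real q / \<sigma>"
  define L where "L = log 2 (real CARD('a))"
  define l where "l = log 2 (real k)"
  have y1: "y \<ge> 1" using \<sigma> q by (simp add: y_def field_simps)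
  obtain M where M: "M \<ge> 1" "real M \<le> 2 * y" "real M \<le> real_of_int \<lceil>y\<rceil> + 1" "1 / (4 * y) \<le> 1 - y / real M"
    by (rule ex_number_of_levels[OF y1])
  define p0 where "p0 = real n powr (- (1 / real M))"
  have p0: "0 < p0" "p0 \<le> 1"
    using n powr_mono[of "- (1 / real M)" 0 "real n"] by (auto simp: p0_def)
  have pn: "p0 * real n = real n powr (1 - 1 / real M)"
    using n by (simp add: p0_def powr_diff powr_minus field_simps)
  \<comment> \<open>This is \<open>\<sigma>\<close> times the slack \<open>1 / (4 * y)\<close> in
    the choice of \<open>M\<close>.\<close>
  define \<epsilon> where "\<epsilon> = \<sigma>^2 / (4 * real q)"
  have \<epsilon>0: "0 < \<epsilon>" using \<sigma> q by (simp add: \<epsilon>_def)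
  have "\<sigma>^2 \<le> 1" using \<sigma> by (simp add: power_le_one)
  then have \<epsilon>1: "\<epsilon> \<le> 1" using q by (simp add: \<epsilon>_def)
  have "\<sigma> * (1 / (4 * y)) \<le> \<sigma> * (1 - y / real M)" using M(4) \<sigma> by (intro mult_left_mono) auto
  moreover have "\<sigma> * (1 / (4 * y)) = \<epsilon>" using \<sigma> q by (simp add: y_def \<epsilon>_def power2_eq_square)
  moreover have "\<sigma> * (1 - y / real M) = \<sigma> - real q / real M" using \<sigma> by (simp add: y_def right_diff_distrib)
  ultimately have \<epsilon>2: "\<epsilon> \<le> \<sigma> - real q / real M" by simp
  have "1 / p0 ^ (M - 1) = p0 * real n"
  proof -
    have "p0 ^ M = real n powr (- 1)"
      using n M(1) by (simp add: p0_def powr_realpow[symmetric] powr_powr)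
    then have "p0 * p0 ^ (M - 1) * real n = 1"
      using n M(1) by (simp add: power_eq_if[of p0 M] powr_minus field_simps)
    then show ?thesis using p0 by (simp add: field_simps)
  qed
  \<comment> \<open>\<open>M \<le> 2 * y\<close> matches the exponent
    \<open>\<sigma> / (2 * q)\<close> in the hypothesis on \<open>\<delta>\<close>.\<close>
  also have "p0 \<le> \<delta>"
  proof -
    have "\<sigma> / (2 * real q) = 1 / (2 * y)" using \<sigma> q by (simp add: y_def)
    also have "\<dots> \<le> 1 / real M" using M y1 by (intro divide_left_mono) auto
    finally have "p0 \<le> real n powr (- (\<sigma> / (2 * real q)))"
      using n unfolding p0_def by (intro powr_mono) auto
    then show ?thesis using \<delta> by linarith
  qed
  then have "p0 * real n \<le> \<delta> * real n" by (intro mult_right_mono) auto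
  finally have kernel: "1 / p0 ^ (M - 1) \<le> \<delta> * real n" .
  have L1: "1 \<le> L" using card2 by (simp add: L_def le_log_iff)
  have l5: "5 \<le> l" using k by (simp add: l_def le_log_iff)
  define A where "A = 2 * real q * (ln (real CARD('a)) + ln (4 * real k)) / \<epsilon>"
  have main: "real k \<le> 4 * real q * A * p0 * real n * L"
    unfolding L_def using nonadaptive_decoder_bound[OF dec nonad lenC _ q n card2 M(1) p0 \<epsilon>0 \<epsilon>1 \<epsilon>2 kernel A_def] k
    by simp
  \<comment> \<open>\<open>k \<ge> 32\<close> gives \<open>l \<ge> 5\<close>, so the constant 5 is
    absorbed by a second factor \<open>l\<close>.\<close>
  have "ln (real CARD('a)) + ln (4 * real k) \<le> L * l^2"
  proof -
    have ln2: "0 < ln (2::real)" "ln (2::real) \<le> 1" using ln_2_less_1 by auto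
    have "log 2 (4 * real k) = log 2 (2 ^ 2) + l" using k by (simp add: l_def log_mult)
    also have "log 2 (2 ^ 2) = (2::real)" by (subst log_nat_power) auto
    finally have "log 2 (4 * real k) = 2 + l" .
    then have "ln (real CARD('a)) + ln (4 * real k) = (L + (2 + l)) * ln 2"
      using ln2 by (simp add: L_def log_def field_simps)
    also have "\<dots> \<le> (L + (2 + l)) * 1" using L1 l5 ln2 by (intro mult_left_mono) auto
    also have "\<dots> \<le> 5 * (L * l)"
    proof -
      have "0 \<le> (L - 1) * (l - 1)" using L1 l5 by simp
      then show ?thesis using L1 l5 by (simp add: algebra_simps)
    qed
    also have "\<dots> \<le> l * (L * l)" using L1 l5 by (intro mult_right_mono) auto
    finally show ?thesis by (simp add: power2_eq_square mult_ac)
  qed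
  then have "2 * real q * (ln (real CARD('a)) + ln (4 * real k)) \<le> 2 * real q * (L * l^2)"
    by (intro mult_left_mono) auto
  then have "\<epsilon> * A \<le> 2 * real q * (L * l^2)" using \<epsilon>0 by (simp add: A_def)
  then have A: "\<sigma>^2 * A \<le> 8 * real q ^ 2 * L * l^2"
    using q by (simp add: \<epsilon>_def field_simps power2_eq_square)
  have "\<sigma>^2 * real k \<le> \<sigma>^2 * (4 * real q * A * p0 * real n * L)"
    by (rule mult_left_mono[OF main]) simp
  also have "\<dots> = (\<sigma>^2 * A) * (4 * real q * L * (p0 * real n))" by (simp only: mult_ac)
  also have "\<dots> \<le> (8 * real q ^ 2 * L * l^2) * (4 * real q * L * (p0 * real n))"
    by (rule mult_right_mono[OF A]) (use L1 p0 in simp)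
  also have "\<dots> = (32 * real q ^ 3 * L^2 * l^2) * (p0 * real n)"
    by (simp add: power2_eq_square power3_eq_cube mult_ac)
  also have "\<dots> \<le> (32 * real q ^ 3 * L^2 * l^2) * real n powr (1 - 1 / (real_of_int \<lceil>y\<rceil> + 1))"
  proof (rule mult_left_mono)
    have "1 / (real_of_int \<lceil>y\<rceil> + 1) \<le> 1 / real M" using M by (intro divide_left_mono) auto
    then show "p0 * real n \<le> real n powr (1 - 1 / (real_of_int \<lceil>y\<rceil> + 1))"
      unfolding pn using n by (intro powr_mono) auto
  qed simp
  finally show ?thesis by (simp add: y_def L_def l_def)
qed

theorem theorem1p1:
  fixes k n q :: nat
    and \<sigma> \<delta> :: real
    and C :: "bool list \<Rightarrow> 'a::finite list"
    and R :: "'r pmf"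
    and B :: "nat \<Rightarrow> 'r \<Rightarrow> 'a oracle_alg"
  assumes "\<sigma> > 0"
    and "\<delta> > real n powr (- (\<sigma> / (2 * real q)))"
    and "\<And>x. length x = k \<Longrightarrow> length (C x) = n"
    and "relaxed_decoder k n q \<delta> \<sigma> C R B"
    and "nonadaptive k n R B"
  shows "real n \<ge>
    (\<sigma>^2 * real k / (38 * real q ^ 4 * (log 2 (real CARD('a)))^2 * (log 2 (real k))^2))
      powr (1 + 1 / real_of_int \<lceil>real q / \<sigma>\<rceil>)"
proof -
  define L where "L = log 2 (real CARD('a))"
  define l where "l = log 2 (real k)"
  define t where "t = real_of_int \<lceil>real q / \<sigma>\<rceil>"
  define X where "X = \<sigma>^2 * real k / (38 * real q ^ 4 * L^2 * l^2)"
  have X0: "0 \<le> X" by (simp add: X_def)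
  have "0 \<le> real q / \<sigma>" using assms(1) by simp
  then have t0: "0 \<le> t" using le_of_int_ceiling[of "real q / \<sigma>"] unfolding t_def by linarith
  \<comment> \<open>Division by 0 yields 0, so a vanishing denominator makes the claimed bound
    trivial.\<close>
  have X_eq_0: "X = 0" if "k = 0 \<or> q = 0 \<or> L = 0 \<or> l = 0"
    using that by (auto simp: X_def)
  have dim: "real k \<le> real n * L" unfolding L_def by (rule code_dimension_le[OF assms(4,3)])
  consider "X = 0" | "0 < X" "X \<le> 1" | "1 < X" using X0 by linarith
  then have "X powr (1 + 1 / t) \<le> real n"
  proof cases
    case 1
    then show ?thesis by simp
  next
    case 2
    then have "k \<noteq> 0" using X_eq_0 by force
    then have "n \<noteq> 0" using dim by (intro notI) simp
    moreover have "X powr (1 + 1 / t) \<le> 1" using 2 t0 by (intro powr_le1) auto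
    ultimately show ?thesis by linarith
  next
    case 3
    then have nz: "k \<noteq> 0" "q \<noteq> 0" "L \<noteq> 0" "l \<noteq> 0" using X_eq_0 by fastforce+
    then have "k \<noteq> 1" by (auto simp: l_def)
    then have k2: "k \<ge> 2" using nz by linarith
    have "CARD('a) \<noteq> 1" using nz by (auto simp: L_def)
    then have card2: "CARD('a) \<ge> 2" using zero_less_card_finite[where 'a = 'a] by linarith
    have n: "n \<ge> 1" using dim nz(1) by (cases n) simp_all
    have \<delta>0: "0 \<le> \<delta>" using assms(2) powr_ge_zero[of "real n"] by (smt (verit))
    have \<sigma>1: "\<sigma> \<le> 1" using decoder_soundness_le_1[OF assms(4) _ \<delta>0 assms(3)] nz by simp
    have L1: "1 \<le> L" using card2 by (simp add: L_def le_log_iff)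
    have l1: "1 \<le> l" using k2 by (simp add: l_def le_log_iff)
    have den: "0 < 38 * real q ^ 4 * L^2 * l^2" using nz by simp
    \<comment> \<open>The denominator of \<open>X\<close> is at least 38, so \<open>X > 1\<close>
      and \<open>\<sigma> \<le> 1\<close> force \<open>k > 38\<close>.\<close>
    have "1 * 1 * 1 \<le> real q ^ 4 * L^2 * l^2"
      using nz(2) L1 l1 by (intro mult_mono one_le_power) auto
    then have "38 \<le> 38 * real q ^ 4 * L^2 * l^2" by simp
    also have "\<dots> < \<sigma>^2 * real k" using 3 den by (simp add: X_def less_divide_eq)
    also have "\<dots> \<le> 1 * real k"
      using assms(1) \<sigma>1 by (intro mult_right_mono power_le_one) auto
    finally have k32: "k \<ge> 32" by simp
    have "1 \<le> real q / \<sigma>" using assms(1) \<sigma>1 nz(2) by (simp add: field_simps)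
    then have t1: "1 \<le> t" using le_of_int_ceiling[of "real q / \<sigma>"] unfolding t_def by linarith
    have "\<sigma>^2 * real k \<le> 32 * real q ^ 3 * L^2 * l^2 * real n powr (1 - 1 / (t + 1))"
      unfolding L_def l_def t_def
      by (rule le_powr_of_decoder[OF assms(1) \<sigma>1 assms(2-5) k32 _ n card2]) (use nz in auto)
    also have "\<dots> \<le> 38 * real q ^ 4 * L^2 * l^2 * real n powr (1 - 1 / (t + 1))"
      using nz(2) by (intro mult_right_mono mult_mono power_increasing) auto
    finally have "X \<le> real n powr (1 - 1 / (t + 1))"
      using den by (simp add: X_def divide_le_eq mult_ac)
    then have "X powr (1 + 1 / t) \<le> (real n powr (1 - 1 / (t + 1))) powr (1 + 1 / t)"
      using X0 t1 by (intro powr_mono2) auto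
    also have "\<dots> = real n powr ((1 - 1 / (t + 1)) * (1 + 1 / t))" by (rule powr_powr)
    \<comment> \<open>The factors are \<open>t / (t + 1)\<close> and its inverse.\<close>
    also have "(1 - 1 / (t + 1)) * (1 + 1 / t) = 1"
    proof -
      have "t + t * t > 0" using t1 by (intro add_pos_pos) auto
      then show ?thesis using t1 by (simp add: field_simps)
    qed
    also have "real n powr 1 = real n" by simp
    finally show ?thesis .
  qed
  then show ?thesis by (simp add: X_def L_def l_def t_def)
qed

end
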